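(* Let $T>0$, $n_0>0$, $\alpha>0$ and $P>0$. For each integer $k\ge1$ let $\omega_k>0$ be the unique positive solution of $2\arctan(\omega_k/\alpha)=k\pi-\omega_k T$, and set $\lambda_k=\frac{2\alpha P}{\alpha^2+\omega_k^2}$ (these are the Mercer eigenvalues on $[0,T]$ of the kernel $R_X(t_1,t_2)=P e^{-\alpha|t_1-t_2|}$). Define $$C(T)=\frac1{2T}\sum_{k=1}^{\infty}\log\left(1+\frac{\lambda_k}{n_0/2}\right),\qquad C_{\mathrm{sh}}=\frac1{4\pi}\int_{-\infty}^{\infty}\log\left(1+\frac{\frac{2P\alpha}{\alpha^2+\omega^2}}{n_0/2}\right)\mathrm{d}\omega .$$ Then for any fixed $T,n_0,\alpha>0$ there exists $\delta>0$ such that $C(T)>C_{\mathrm{sh}}$ holds strictly for every $P$ with $0<P<\delta$.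
   Context: Setting: the transmitted signal is a zero-mean stationary Gaussian process with autocorrelation $R_X(\tau)=Pe^{-\alpha|\tau|}$ (power spectral density $S_X(\omega)=2P\alpha/(\alpha^2+\omega^2)$), corrupted by additive white Gaussian noise of power spectral density $n_0/2$; $C(T)$ is the finite-time transmission rate over the window $[0,T]$ and $C_{\mathrm{sh}}$ is the Shannon capacity. Logarithms are natural. *)

theory Defs
  imports "HOL-Analysis.Analysis"
begin

definition omega_k :: "real \<Rightarrow> real \<Rightarrow> nat \<Rightarrow> real" where
  "omega_k T \<alpha> k = (THE w. w > 0 \<and> 2 * arctan (w / \<alpha>) = real k * pi - w * T)"

text \<open>Mercer eigenvalues of P exp(-alpha |t1 - t2|) on [0,T].\<close>
definition lambda_k :: "real \<Rightarrow> real \<Rightarrow> real \<Rightarrow> nat \<Rightarrow> real" where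
  "lambda_k T \<alpha> P k = 2 * \<alpha> * P / (\<alpha>\<^sup>2 + (omega_k T \<alpha> k)\<^sup>2)"

definition C_T :: "real \<Rightarrow> real \<Rightarrow> real \<Rightarrow> real \<Rightarrow> real" where
  "C_T T n0 \<alpha> P = 1 / (2 * T) * (\<Sum>k. ln (1 + lambda_k T \<alpha> P (Suc k) / (n0 / 2)))"

definition C_sh :: "real \<Rightarrow> real \<Rightarrow> real \<Rightarrow> real" where
  "C_sh n0 \<alpha> P = 1 / (4 * pi) *
     (\<integral>\<omega>. ln (1 + (2 * P * \<alpha> / (\<alpha>\<^sup>2 + \<omega>\<^sup>2)) / (n0 / 2)) \<partial>lborel)"

end

theory Submission
  imports Defs "HOL-Real_Asymp.Real_Asymp"
begin

text \<open>
  Both rates have closed forms. Write \<open>a\<close> for \<open>\<alpha>\<close> and \<open>b = sqrt (a\<^sup>2 + 4 a P / n0)\<close>, so that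
  \<open>1 + \<lambda>\<^sub>k / (n0 / 2) = (b\<^sup>2 + \<omega>\<^sub>k\<^sup>2) / (a\<^sup>2 + \<omega>\<^sub>k\<^sup>2)\<close>. Then \<open>2 T C_sh = (b - a) T\<close>, and
  \<open>2 T C(T) = ln (((a + b)\<^sup>2 exp (b T) - (b - a)\<^sup>2 exp (- b T)) / (4 a b)) - a T\<close>. The difference is positive
  because \<open>(a + b)\<^sup>2 - 4 a b = (b - a)\<^sup>2 > (b - a)\<^sup>2 exp (- 2 b T)\<close>; this holds for every \<open>P > 0\<close>.

  The numbers \<open>\<plusminus>\<omega>\<^sub>k\<close> and \<open>0\<close> are the zeros of the entire function \<open>Im (exp (i x T) (a + i x)\<^sup>2)\<close>, and the infinite
  product is obtained without Hadamard factorization by replacing \<open>exp (i x T)\<close> with \<open>(1 + i x T / n) ^ n\<close>. For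
  odd \<open>n\<close> this gives a polynomial of degree \<open>n + 2\<close> with \<open>n + 2\<close> distinct real zeros, namely the solutions of
  \<open>n arctan (x T / n) + 2 arctan (x / a) = k \<pi>\<close>. Evaluating it at \<open>i b\<close> and \<open>i a\<close> gives a finite product, and
  Tannery's theorem justifies the limit.
\<close>

section \<open>Splitting a polynomial into linear factors\<close>

text \<open>Dividing off one root at a time lowers the degree by one, so only a constant, possibly
  0, is left at the end.\<close>

lemma poly_eq_smult_prod_roots:
  fixes p :: "'a::field poly"
  assumes "finite R" "\<And>r. r \<in> R \<Longrightarrow> poly p r = 0" "degree p \<le> card R"
  shows "\<exists>c. p = smult c (\<Prod>r\<in>R. [:-r, 1:])"
  using assms
proof (induction R arbitrary: p rule: finite_induct)
  case empty
  then show ?case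
    by (auto elim!: degree_eq_zeroE)
next
  case (insert r R)
  from insert.prems(1)[of r] obtain q where q: "p = [:-r, 1:] * q"
    by (auto simp: poly_eq_0_iff_dvd elim!: dvdE)
  show ?case
  proof (cases "q = 0")
    case True
    then show ?thesis
      using q by (intro exI[of _ 0]) simp
  next
    case False
    then have "degree p = Suc (degree q)"
      unfolding q by (subst degree_mult_eq) auto
    then have "degree q \<le> card R"
      using insert by simp
    moreover have "poly q s = 0" if "s \<in> R" for s
      using insert.prems(1)[of s] insert.hyps(2) that unfolding q by auto
    ultimately obtain c where "q = smult c (\<Prod>r\<in>R. [:-r, 1:])"
      using insert.IH by blast
    then show ?thesis
      using q insert.hyps by (intro exI[of _ c]) (simp add: mult_smult_right)
  qed
qed

section \<open>The phase functions and the points where they reach multiples of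
  \<open>pi\<close>\<close>

text \<open>For \<open>a > 0\<close> this is a continuous argument of
  \<open>exp (\<i> x T) (a + \<i> x)^2\<close>; its positive point at level \<open>k * pi\<close> is
  \<open>omega_k T a k\<close>.\<close>

definition phase :: "real \<Rightarrow> real \<Rightarrow> real \<Rightarrow> real" where
  "phase T a x = x * T + 2 * arctan (x / a)"

text \<open>The argument after \<open>exp (\<i> x T)\<close> is replaced with
  \<open>(1 + \<i> x T / n) ^ n\<close>: each of the \<open>n\<close> factors contributes one
  arctangent.\<close>

definition phase_approx :: "nat \<Rightarrow> real \<Rightarrow> real \<Rightarrow> real \<Rightarrow> real" where
  "phase_approx n T a x = real n * arctan (x * T / real n) + 2 * arctan (x / a)"

lemma phase_approx_minus: "phase_approx n T a (- x) = - phase_approx n T a x"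
  by (simp add: phase_approx_def arctan_minus)

lemma phase_strict_mono:
  assumes "T > 0" "a > 0" "x < y"
  shows "phase T a x < phase T a y"
  unfolding phase_def using assms
  by (intro add_strict_mono) (auto simp: arctan_less_iff divide_strict_right_mono)

lemma phase_approx_strict_mono:
  assumes "T > 0" "a > 0" "n > 0" "x < y"
  shows "phase_approx n T a x < phase_approx n T a y"
  unfolding phase_approx_def using assms
  by (intro add_strict_mono) (auto simp: arctan_less_iff divide_strict_right_mono)

lemma arctan_le_self:
  assumes "0 \<le> x" shows "arctan x \<le> (x::real)"
proof -
  have "0 - arctan 0 \<le> x - arctan x"
  proof (rule DERIV_nonneg_imp_nondecreasing[OF assms])
    fix y :: real
    show "\<exists>z. ((\<lambda>x. x - arctan x) has_real_derivative z) (at y) \<and> 0 \<le> z"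
      by (rule exI[of _ "1 - inverse (1 + y\<^sup>2)"])
         (auto intro!: derivative_eq_intros simp: field_simps add_pos_nonneg)
  qed
  then show ?thesis by simp
qed

text \<open>The right side is free of \<open>n\<close>, which later makes the lower bound on the
  approximate roots uniform in \<open>n\<close>.\<close>

lemma phase_approx_le_phase:
  assumes "T > 0" "n > 0" "0 \<le> x"
  shows "phase_approx n T a x \<le> phase T a x"
  using arctan_le_self[of "x * T / real n"] assms
  by (simp add: phase_approx_def phase_def field_simps)

lemma ex1_phase:
  assumes "T > 0" "a > 0" "y > 0"
  shows "\<exists>!x. x > 0 \<and> phase T a x = y"
proof (rule ex_ex1I)
  \<comment> \<open>At \<open>y / T\<close> the linear term alone equals \<open>y\<close>, and the
    arctangent is nonnegative there.\<close>
  have "phase T a 0 \<le> y" "y \<le> phase T a (y / T)"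
    using assms by (auto simp: phase_def)
  moreover have "\<forall>x. 0 \<le> x \<and> x \<le> y / T \<longrightarrow> isCont (phase T a) x"
    unfolding phase_def using assms by (auto intro!: continuous_intros)
  ultimately obtain x where x: "0 \<le> x" "phase T a x = y"
    using IVT[of "phase T a" 0 y "y / T"] assms by auto
  moreover have "x \<noteq> 0"
    using x assms by (auto simp: phase_def)
  ultimately show "\<exists>x. x > 0 \<and> phase T a x = y"
    by (intro exI[of _ x]) auto
next
  fix u v assume "u > 0 \<and> phase T a u = y" "v > 0 \<and> phase T a v = y"
  then show "u = v"
    using phase_strict_mono[OF assms(1,2), of u v] phase_strict_mono[OF assms(1,2), of v u]
    by (cases u v rule: linorder_cases) auto
qed

lemma phase_omega_k:
  assumes "T > 0" "a > 0" "k > 0"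
  shows "phase T a (omega_k T a k) = real k * pi"
proof -
  have "omega_k T a k = (THE x. x > 0 \<and> phase T a x = real k * pi)"
    unfolding omega_k_def phase_def by (intro arg_cong[of _ _ The] ext) auto
  then show ?thesis
    using theI'[OF ex1_phase[OF assms(1,2), of "real k * pi"]] assms(3) by auto
qed

text \<open>The upper threshold is the limit at infinity of the approximate phase: its
  \<open>n + 2\<close> arctangents, counted with multiplicity, tend to \<open>pi / 2\<close>
  each.\<close>

lemma ex_phase_approx:
  assumes "T > 0" "a > 0" "n > 0" "0 < y" "y < real (n + 2) * pi / 2"
  shows "\<exists>x>0. phase_approx n T a x = y"
proof -
  have 1: "filterlim (\<lambda>x. x * T / real n) at_top at_top" "filterlim (\<lambda>x. x / a) at_top at_top"
    using assms by real_asymp+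
  have "((\<lambda>x. phase_approx n T a x) \<longlongrightarrow> real n * (pi / 2) + 2 * (pi / 2)) at_top"
    unfolding phase_approx_def
    by (intro tendsto_intros filterlim_compose[OF tendsto_arctan_at_top] 1)
  then have "eventually (\<lambda>x. phase_approx n T a x > y) at_top"
    by (rule order_tendstoD) (use assms in \<open>simp add: field_simps\<close>)
  then have "eventually (\<lambda>x. phase_approx n T a x > y \<and> x \<ge> 0) at_top"
    using eventually_ge_at_top[of 0] by eventually_elim auto
  then obtain X where X: "phase_approx n T a X > y" "X \<ge> 0"
    using eventually_happens'[OF trivial_limit_at_top_linorder] by blast
  have "\<forall>x. 0 \<le> x \<and> x \<le> X \<longrightarrow> isCont (phase_approx n T a) x"
    unfolding phase_approx_def using assms by (auto intro!: continuous_intros)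
  then obtain x where x: "0 \<le> x" "phase_approx n T a x = y"
    using IVT[of "phase_approx n T a" 0 y X] X assms by (auto simp: phase_approx_def)
  moreover have "x \<noteq> 0"
    using x assms by (auto simp: phase_approx_def)
  ultimately show ?thesis
    by (intro exI[of _ x]) auto
qed

section \<open>The approximating polynomial and the finite product\<close>

lemma one_plus_ii_arctan: "1 + \<i> * complex_of_real y = complex_of_real (sqrt (1 + y\<^sup>2)) * cis (arctan y)"
  by (simp add: complex_eq_iff cos_arctan sin_arctan add_pos_nonneg less_imp_neq[symmetric])

lemma of_real_sqrt_power2:
  "(complex_of_real (sqrt (1 + y\<^sup>2)))\<^sup>2 = 1 + (complex_of_real y)\<^sup>2"
  by (subst of_real_power[symmetric]) simp

text \<open>At a real point the second product is the conjugate of the first, so this is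
  \<open>2 * \<i>\<close> times an imaginary part. With the conjugate written out it is a
  polynomial, which can also be evaluated on the imaginary axis.\<close>

definition phase_poly :: "nat \<Rightarrow> real \<Rightarrow> real \<Rightarrow> complex poly" where
  "phase_poly n T a =
     [:1, \<i> * of_real (T / real n):] ^ n * [:of_real a, \<i>:]\<^sup>2
   - [:1, - \<i> * of_real (T / real n):] ^ n * [:of_real a, - \<i>:]\<^sup>2"

lemma degree_phase_poly: "degree (phase_poly n T a) \<le> n + 2"
proof -
  have *: "degree ([:1, u:] ^ n * [:c, v:]\<^sup>2) \<le> n + 2" for u v c :: complex
  proof -
    have "degree ([:1, u:] ^ n) \<le> n" "degree ([:c, v:] ^ 2) \<le> 2"
      using degree_power_le[of "[:1, u:]" n] degree_power_le[of "[:c, v:]" 2]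
      by (auto split: if_splits)
    then show ?thesis
      using degree_mult_le[of "[:1, u:] ^ n" "[:c, v:]\<^sup>2"] by linarith
  qed
  show ?thesis
    unfolding phase_poly_def by (intro degree_diff_le *)
qed

text \<open>In polar form the imaginary part is a positive modulus times the sine of the approximate
  phase, so the real zeros are the points whose phase is a multiple of \<open>pi\<close>.\<close>

lemma phase_poly_of_real:
  assumes "a > 0"
  shows "poly (phase_poly n T a) (of_real x) =
    2 * \<i> * of_real (sqrt (1 + (x * T / n)\<^sup>2) ^ n * (a\<^sup>2 * (1 + (x / a)\<^sup>2)) * sin (phase_approx n T a x))"
proof -
  define A where "A = (1 + \<i> * of_real (x * T / n)) ^ n * (of_real a * (1 + \<i> * of_real (x / a)))\<^sup>2"
  have A: "A = (1 + \<i> * of_real (x * T / n)) ^ n * (of_real a + \<i> * of_real x)\<^sup>2"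
    using assms by (simp add: A_def distrib_left)
  have "poly (phase_poly n T a) (of_real x) = A - cnj A"
    by (simp add: A phase_poly_def mult_ac)
  also have "\<dots> = 2 * \<i> * of_real (Im A)"
    by (simp add: complex_eq_iff)
  also have "A = of_real (sqrt (1 + (x * T / n)\<^sup>2) ^ n * (a\<^sup>2 * (sqrt (1 + (x / a)\<^sup>2))\<^sup>2)) * cis (phase_approx n T a x)"
    unfolding A_def one_plus_ii_arctan phase_approx_def
    by (simp add: of_real_sqrt_power2 power_mult_distrib Complex.DeMoivre cis_mult[symmetric] mult_ac)
  also have "Im \<dots> = sqrt (1 + (x * T / n)\<^sup>2) ^ n * (a\<^sup>2 * (1 + (x / a)\<^sup>2)) * sin (phase_approx n T a x)"
  proof -
    have sq: "(sqrt (1 + (x / a)\<^sup>2))\<^sup>2 = 1 + (x / a)\<^sup>2"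
      by simp
    show ?thesis
      unfolding sq by (simp del: of_real_mult of_real_power)
  qed
  finally show ?thesis .
qed

lemma phase_poly_ii:
  "poly (phase_poly n T a) (\<i> * of_real b) =
     of_real ((1 - b * T / n) ^ n * (a - b)\<^sup>2 - (1 + b * T / n) ^ n * (a + b)\<^sup>2)"
  by (simp add: phase_poly_def field_simps)

text \<open>The zeros 0 and \<open>r j\<close>, \<open>- r j\<close> exhaust the degree, so
  \<open>phase_poly\<close> is a constant times \<open>z\<close> times the product of the
  \<open>z^2 - (r j)^2\<close>. Comparing its values at \<open>\<i> * b\<close> and
  \<open>\<i> * a\<close> removes the constant.\<close>

lemma finite_product:
  fixes r :: "nat \<Rightarrow> real"
  assumes "T > 0" "a > 0" "b > 0" and n: "n = 2 * m + 1"
    and r: "\<And>j. j \<le> m \<Longrightarrow> r j > 0" "\<And>j. j \<le> m \<Longrightarrow> phase_approx n T a (r j) = real (Suc j) * pi"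
  shows "(\<Prod>j\<le>m. (b\<^sup>2 + (r j)\<^sup>2) / (a\<^sup>2 + (r j)\<^sup>2)) =
    ((1 + b * T / n) ^ n * (a + b)\<^sup>2 - (1 - b * T / n) ^ n * (a - b)\<^sup>2)
      / (4 * a * b * (1 + a * T / n) ^ n)"
proof -
  define R1 :: "complex set" where "R1 = (\<lambda>j. of_real (r j)) ` {..m}"
  define R2 :: "complex set" where "R2 = (\<lambda>j. - of_real (r j)) ` {..m}"
  let ?R = "insert 0 (R1 \<union> R2)"
  have inj: "inj_on r {..m}"
    by (rule inj_onI) (metis atMost_iff mult_cancel_right of_nat_eq_iff pi_neq_zero r(2) nat.inject)
  have inj1: "inj_on (\<lambda>j. complex_of_real (r j)) {..m}" "inj_on (\<lambda>j. - complex_of_real (r j)) {..m}"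
    using inj by (auto simp: inj_on_def)
  have fin: "finite R1" "finite R2"
    by (auto simp: R1_def R2_def)
  have disj: "R1 \<inter> R2 = {}"
  proof -
    have "complex_of_real (r i) \<noteq> - complex_of_real (r j)" if "i \<le> m" "j \<le> m" for i j
    proof -
      have "r i \<noteq> - r j" using r(1)[OF that(1)] r(1)[OF that(2)] by linarith
      then show ?thesis by (metis of_real_eq_iff of_real_minus)
    qed
    then show ?thesis by (auto simp: R1_def R2_def)
  qed
  have zero: "0 \<notin> R1 \<union> R2"
    using r(1) by (force simp: R1_def R2_def)
  \<comment> \<open>There are \<open>2 * (m + 1) + 1\<close> zeros, which is \<open>n + 2\<close>
    for \<open>n = 2 * m + 1\<close>.\<close>
  have "card ?R = n + 2"
    using fin disj zero inj1 by (simp add: card_Un_disjoint R1_def R2_def card_image n)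
  moreover have "poly (phase_poly n T a) z = 0" if "z \<in> ?R" for z
  proof -
    have "\<exists>x k. z = of_real x \<and> phase_approx n T a x = of_int k * pi"
    proof -
      consider "z = 0" | j where "j \<le> m" "z = of_real (r j)" | j where "j \<le> m" "z = of_real (- r j)"
        using \<open>z \<in> ?R\<close> by (auto simp: R1_def R2_def)
      then show ?thesis
      proof cases
        case 1
        then show ?thesis by (intro exI[of _ 0]) (simp add: phase_approx_def)
      next
        case (2 j)
        then show ?thesis using r(2)[of j]
          by (intro exI[of _ "r j"] exI[of _ "int (Suc j)"]) simp
      next
        case (3 j)
        then show ?thesis using r(2)[of j]
          by (intro exI[of _ "- r j"] exI[of _ "- int (Suc j)"]) (simp add: phase_approx_minus algebra_simps)
      qed
    qed
    then obtain x k where "z = of_real x" "phase_approx n T a x = of_int k * pi"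
      by blast
    then show ?thesis
      using phase_poly_of_real[OF \<open>a > 0\<close>, of n T x] by (simp add: mult.commute sin_zero_iff_int2)
  qed
  ultimately obtain c where c: "phase_poly n T a = smult c (\<Prod>z\<in>?R. [:-z, 1:])"
    using poly_eq_smult_prod_roots[of ?R "phase_poly n T a"] degree_phase_poly[of n T a] fin by auto
  \<comment> \<open>Each pair of opposite zeros contributes \<open>-(y^2 + (r j)^2)\<close>; the
    signs and the factor \<open>\<i>\<close> go into a constant independent of
    \<open>y\<close>.\<close>
  have ev: "poly (phase_poly n T a) (\<i> * of_real y) =
      (c * (-1) ^ Suc m * \<i>) * of_real (y * (\<Prod>j\<le>m. y\<^sup>2 + (r j)\<^sup>2))" for y
  proof -
    have "poly (phase_poly n T a) (\<i> * of_real y) = c * (\<Prod>z\<in>?R. \<i> * of_real y - z)"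
      unfolding c by (simp add: poly_prod)
    also have "(\<Prod>z\<in>?R. \<i> * of_real y - z) = \<i> * of_real y *
        ((\<Prod>j\<le>m. \<i> * of_real y - of_real (r j)) * (\<Prod>j\<le>m. \<i> * of_real y + of_real (r j)))"
      using fin disj zero inj1
      by (simp add: prod.union_disjoint) (simp add: R1_def R2_def prod.reindex)
    also have "(\<Prod>j\<le>m. \<i> * of_real y - of_real (r j)) * (\<Prod>j\<le>m. \<i> * of_real y + of_real (r j))
      = (\<Prod>j\<le>m. (-1) * complex_of_real (y\<^sup>2 + (r j)\<^sup>2))"
      unfolding prod.distrib[symmetric]
      by (intro prod.cong) (auto simp: algebra_simps power2_eq_square)
    also have "\<dots> = (-1) ^ Suc m * of_real (\<Prod>j\<le>m. y\<^sup>2 + (r j)\<^sup>2)"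
      by (subst prod.distrib) simp
    finally show ?thesis by (simp add: mult_ac)
  qed
  define K where "K = c * (-1) ^ Suc m * \<i>"
  define Q where "Q y = (\<Prod>j\<le>m. y\<^sup>2 + (r j)\<^sup>2)" for y
  define g where "g y = (1 - y * T / n) ^ n * (a - y)\<^sup>2 - (1 + y * T / n) ^ n * (a + y)\<^sup>2" for y
  have Kg: "K * of_real (y * Q y) = of_real (g y)" for y
    using ev[of y] phase_poly_ii[of n T a y] unfolding K_def Q_def g_def by simp
  \<comment> \<open>At \<open>y = a\<close> the factor \<open>(a - y)^2\<close> kills the first
    term, which keeps the denominator of the product simple.\<close>
  have ga: "g a = - (4 * a\<^sup>2 * (1 + a * T / n) ^ n)"
    by (simp add: g_def power2_eq_square)
  have pos: "(1 + a * T / n) ^ n > 0"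
    using assms by (intro zero_less_power) (auto intro!: add_pos_nonneg)
  have Qa: "Q a > 0"
    unfolding Q_def using assms by (intro prod_pos) (auto intro!: add_pos_nonneg)
  \<comment> \<open>Both sides equal \<open>K * (a * Q a) * (b * Q b)\<close>, so \<open>K\<close>
    drops out.\<close>
  have "complex_of_real (g b * (a * Q a)) = of_real (g a * (b * Q b))"
    using Kg[of a, symmetric] Kg[of b, symmetric] by (simp add: mult_ac)
  then have "g b * (a * Q a) = g a * (b * Q b)"
    by (simp only: of_real_eq_iff)
  then have "a * (Q b * (4 * a * b * (1 + a * T / n) ^ n)) = a * (- g b * Q a)"
    unfolding ga by (simp add: power2_eq_square algebra_simps)
  then have "Q b * (4 * a * b * (1 + a * T / n) ^ n) = - g b * Q a"
    using assms by (subst (asm) mult_left_cancel) auto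
  moreover have "4 * a * b * (1 + a * T / n) ^ n \<noteq> 0"
    using less_imp_neq[OF pos] assms(2,3) by simp
  ultimately have "Q b / Q a = (- g b) / (4 * a * b * (1 + a * T / n) ^ n)"
    using Qa by (subst frac_eq_eq) auto
  then show ?thesis
    unfolding Q_def g_def prod_dividef by simp
qed

section \<open>From the finite products to the infinite one\<close>

lemma phase_approx_tendsto:
  assumes "T > 0"
  shows "(\<lambda>m. phase_approx (2 * m + 1) T a x) \<longlonglongrightarrow> phase T a x"
proof -
  have "(\<lambda>m. real (2 * m + 1) * arctan (x * T / real (2 * m + 1))) \<longlonglongrightarrow> x * T"
    using assms by (cases x "0::real" rule: linorder_cases) (simp_all, real_asymp+)
  then show ?thesis
    unfolding phase_approx_def phase_def by (intro tendsto_add tendsto_const)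
qed

text \<open>Pointwise convergence suffices by monotonicity: for \<open>u < w\<close> the approximate
  phase at \<open>u\<close> is eventually below \<open>y\<close>, which forces the root to the right
  of \<open>u\<close>; the other side is symmetric.\<close>

lemma phase_approx_root_tendsto:
  assumes "T > 0" "a > 0" "phase T a w = y" "\<forall>\<^sub>F m in sequentially. phase_approx (2 * m + 1) T a (r m) = y"
  shows "r \<longlonglongrightarrow> w"
proof (rule order_tendstoI)
  fix u assume "u < w"
  then have "phase T a u < y"
    using phase_strict_mono assms by blast
  from order_tendstoD(2)[OF phase_approx_tendsto[OF assms(1)] this] assms(4)
  show "\<forall>\<^sub>F m in sequentially. u < r m"
  proof eventually_elim
    case (elim m)
    then show ?case
      using phase_approx_strict_mono[OF assms(1,2), of "2 * m + 1" "r m" u]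
      by (cases "r m" u rule: linorder_cases) auto
  qed
next
  fix u assume "w < u"
  then have "y < phase T a u"
    using phase_strict_mono assms by blast
  from order_tendstoD(1)[OF phase_approx_tendsto[OF assms(1)] this] assms(4)
  show "\<forall>\<^sub>F m in sequentially. r m < u"
  proof eventually_elim
    case (elim m)
    then show ?case
      using phase_approx_strict_mono[OF assms(1,2), of "2 * m + 1" u "r m"]
      by (cases "r m" u rule: linorder_cases) auto
  qed
qed

text \<open>The term \<open>2 * arctan (x / a)\<close> supplies less than one \<open>pi\<close>, so
  \<open>x * T\<close> must supply the other \<open>j\<close>. The bound does not depend on
  \<open>n\<close>, as domination requires.\<close>

lemma phase_approx_root_lower_bound:
  assumes "T > 0" "n > 0" "x > 0" "phase_approx n T a x = real (Suc j) * pi"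
  shows "real j * pi / T \<le> x"
proof -
  have "real (Suc j) * pi \<le> x * T + 2 * arctan (x / a)"
    using phase_approx_le_phase[of T n x a] assms by (simp add: phase_def)
  moreover have "2 * arctan (x / a) < pi"
    using arctan_ubound[of "x / a"] by simp
  ultimately have "real j * pi \<le> x * T"
    by (simp add: algebra_simps)
  then show ?thesis
    using assms by (simp add: field_simps)
qed

lemma tendsto_exp_odd: "(\<lambda>m. (1 + y * T / real (2 * m + 1)) ^ (2 * m + 1)) \<longlonglongrightarrow> exp (y * T)"
proof -
  have "strict_mono (\<lambda>m::nat. 2 * m + 1)"
    by (rule strict_monoI) simp
  from LIMSEQ_subseq_LIMSEQ[OF tendsto_exp_limit_sequentially this, of "y * T"]
  show ?thesis by (simp add: o_def)
qed

text \<open>This is the dominating series for Tannery's theorem.\<close>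

lemma summable_inverse_quadratic:
  fixes a T x :: real
  assumes "T > 0" "a > 0" "x > 0"
  shows "summable (\<lambda>j. x / (a\<^sup>2 + (real j * pi / T)\<^sup>2))"
proof (rule summable_comparison_test_ev)
  show "summable (\<lambda>j. x * T\<^sup>2 * inverse (real j ^ 2))"
    by (intro summable_mult inverse_power_summable) simp
  \<comment> \<open>The comparison fails at \<open>j = 0\<close>, where \<open>inverse 0 = 0\<close>
    makes the right side vanish.\<close>
  show "\<forall>\<^sub>F j in sequentially. norm (x / (a\<^sup>2 + (real j * pi / T)\<^sup>2)) \<le> x * T\<^sup>2 * inverse (real j ^ 2)"
    using eventually_gt_at_top[of 0]
  proof eventually_elim
    case (elim j)
    have "(real j / T)\<^sup>2 \<le> (real j * pi / T)\<^sup>2"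
      using assms pi_gt3 mult_left_mono[of 1 pi "real j"]
      by (intro power_mono divide_right_mono) auto
    also have "\<dots> \<le> a\<^sup>2 + (real j * pi / T)\<^sup>2" by simp
    finally have "x / (a\<^sup>2 + (real j * pi / T)\<^sup>2) \<le> x / (real j / T)\<^sup>2"
      using assms elim by (intro divide_left_mono mult_pos_pos) (auto intro: add_pos_nonneg)
    also have "\<dots> = x * T\<^sup>2 * inverse (real j ^ 2)"
      by (simp add: power_divide field_simps)
    finally show ?case
      using assms by simp
  qed
qed

lemma one_plus_diff_divide:
  fixes a b w :: real
  assumes "a \<noteq> 0"
  shows "1 + (b\<^sup>2 - a\<^sup>2) / (a\<^sup>2 + w\<^sup>2) = (b\<^sup>2 + w\<^sup>2) / (a\<^sup>2 + w\<^sup>2)"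
proof -
  have "a\<^sup>2 + w\<^sup>2 \<noteq> 0"
    using assms by (simp add: sum_power2_eq_zero_iff)
  then have "1 + (b\<^sup>2 - a\<^sup>2) / (a\<^sup>2 + w\<^sup>2) = (a\<^sup>2 + w\<^sup>2 + (b\<^sup>2 - a\<^sup>2)) / (a\<^sup>2 + w\<^sup>2)"
    by (subst add_divide_distrib) simp
  then show ?thesis by simp
qed

text \<open>Logarithms of \<open>finite_product\<close> are taken with \<open>n = 2 * m + 1\<close>,
  and \<open>m\<close> tends to infinity: Tannery's theorem handles the sum, the limit
  \<open>(1 + y T / n) ^ n\<close> to \<open>exp (y T)\<close> the closed form.\<close>

lemma suminf_ln_omega_k:
  assumes "T > 0" "a > 0" "b > a"
  shows "(\<Sum>k. ln (1 + (b\<^sup>2 - a\<^sup>2) / (a\<^sup>2 + (omega_k T a (Suc k))\<^sup>2))) =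
    ln ((exp (b * T) * (a + b)\<^sup>2 - exp (- b * T) * (a - b)\<^sup>2) / (4 * a * b * exp (a * T)))"
proof -
  define x where "x = b\<^sup>2 - a\<^sup>2"
  have "x > 0" using assms by (simp add: x_def power_strict_mono)
  \<comment> \<open>The level \<open>j + 1\<close> is at most \<open>m + 1\<close>, which is below
    \<open>(n + 2) / 2 = m + 3 / 2\<close>.\<close>
  have "\<exists>r>0. phase_approx (2 * m + 1) T a r = real (Suc j) * pi" if "j \<le> m" for j m
  proof (rule ex_phase_approx)
    have "2 * real (Suc j) < real (2 * m + 1 + 2)"
      using that by simp
    then have "2 * real (Suc j) * pi < real (2 * m + 1 + 2) * pi"
      by (intro mult_strict_right_mono) auto
    then show "real (Suc j) * pi < real (2 * m + 1 + 2) * pi / 2"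
      by simp
  qed (use assms in auto)
  then obtain r where r: "\<And>j m. j \<le> m \<Longrightarrow> r j m > 0"
      "\<And>j m. j \<le> m \<Longrightarrow> phase_approx (2 * m + 1) T a (r j m) = real (Suc j) * pi"
    by metis
  \<comment> \<open>Padding with 0 turns the finite sums into series over one fixed index set, the
    form that Tannery's theorem takes.\<close>
  define A where "A j m = (if j \<le> m then ln (1 + x / (a\<^sup>2 + (r j m)\<^sup>2)) else 0)" for j m
  define B where "B j = ln (1 + x / (a\<^sup>2 + (omega_k T a (Suc j))\<^sup>2))" for j
  define N where "N y m = (1 + y * T / real (2 * m + 1)) ^ (2 * m + 1)" for y and m :: nat
  have "(\<lambda>m. A j m) \<longlonglongrightarrow> B j" for j
  proof -
    have "(\<lambda>m. r j m) \<longlonglongrightarrow> omega_k T a (Suc j)"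
      proof (rule phase_approx_root_tendsto[OF assms(1,2) phase_omega_k])
      show "\<forall>\<^sub>F m in sequentially. phase_approx (2 * m + 1) T a (r j m) = real (Suc j) * pi"
        using eventually_ge_at_top[of j] by eventually_elim (rule r(2))
    qed (use assms in auto)
    then have "(\<lambda>m. ln (1 + x / (a\<^sup>2 + (r j m)\<^sup>2))) \<longlonglongrightarrow> B j"
      unfolding B_def using assms \<open>x > 0\<close>
      by (intro tendsto_intros) (auto simp: add_pos_nonneg less_imp_neq[symmetric])
    then show ?thesis
      by (rule Lim_transform_eventually) (auto intro!: eventually_mono[OF eventually_ge_at_top[of j]] simp: A_def)
  qed
  moreover have "norm (A j m) \<le> x / (a\<^sup>2 + (real j * pi / T)\<^sup>2)" for j m
  proof (cases "j \<le> m")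
    case True
    have "real j * pi / T \<le> r j m"
      using phase_approx_root_lower_bound[OF assms(1) _ r(1)[OF True] r(2)[OF True]] by simp
    then have le: "x / (a\<^sup>2 + (r j m)\<^sup>2) \<le> x / (a\<^sup>2 + (real j * pi / T)\<^sup>2)"
      using assms \<open>x > 0\<close>
      by (intro divide_left_mono add_left_mono power_mono mult_pos_pos) (auto intro!: add_pos_nonneg)
    have "x / (a\<^sup>2 + (r j m)\<^sup>2) \<ge> 0" using \<open>x > 0\<close> by simp
    then have "\<bar>ln (1 + x / (a\<^sup>2 + (r j m)\<^sup>2))\<bar> \<le> x / (a\<^sup>2 + (r j m)\<^sup>2)"
      using ln_add_one_self_le_self by simp
    then show ?thesis
      using le True by (simp add: A_def)
  qed (use \<open>x > 0\<close> in \<open>simp add: A_def\<close>)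
  then have "\<forall>\<^sub>F (j, m) in sequentially \<times>\<^sub>F sequentially. norm (A j m) \<le> x / (a\<^sup>2 + (real j * pi / T)\<^sup>2)"
    by (intro always_eventually) auto
  ultimately have "(\<lambda>m. \<Sum>j. A j m) \<longlonglongrightarrow> (\<Sum>j. B j)"
    using tannerys_theorem[of A B sequentially "\<lambda>j. x / (a\<^sup>2 + (real j * pi / T)\<^sup>2)"]
      summable_inverse_quadratic[OF assms(1,2) \<open>x > 0\<close>] by simp
  moreover have "(\<Sum>j. A j m) = ln ((N b m * (a + b)\<^sup>2 - N (- b) m * (a - b)\<^sup>2) / (4 * a * b * N a m))" for m
  proof -
    have pos: "a\<^sup>2 + (r j m)\<^sup>2 > 0" for j
      using assms by (auto intro!: add_pos_nonneg)
    have "(\<Sum>j. A j m) = (\<Sum>j\<le>m. A j m)"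
      by (rule suminf_finite) (auto simp: A_def)
    also have "\<dots> = (\<Sum>j\<le>m. ln ((b\<^sup>2 + (r j m)\<^sup>2) / (a\<^sup>2 + (r j m)\<^sup>2)))"
    proof (rule sum.cong)
      fix j assume "j \<in> {..m}"
      moreover have "1 + x / (a\<^sup>2 + (r j m)\<^sup>2) = (b\<^sup>2 + (r j m)\<^sup>2) / (a\<^sup>2 + (r j m)\<^sup>2)"
        unfolding x_def using assms by (intro one_plus_diff_divide) simp
      ultimately show "A j m = ln ((b\<^sup>2 + (r j m)\<^sup>2) / (a\<^sup>2 + (r j m)\<^sup>2))"
        by (simp add: A_def)
    qed simp
    also have "\<dots> = ln (\<Prod>j\<le>m. (b\<^sup>2 + (r j m)\<^sup>2) / (a\<^sup>2 + (r j m)\<^sup>2))"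
      using assms pos by (intro ln_prod[symmetric]) (auto intro!: divide_pos_pos add_pos_nonneg)
    also have "(\<Prod>j\<le>m. (b\<^sup>2 + (r j m)\<^sup>2) / (a\<^sup>2 + (r j m)\<^sup>2)) =
        (N b m * (a + b)\<^sup>2 - N (- b) m * (a - b)\<^sup>2) / (4 * a * b * N a m)"
      using finite_product[OF assms(1,2) _ refl, of b m "\<lambda>j. r j m"] r assms unfolding N_def by simp
    finally show ?thesis .
  qed
  moreover have "(\<lambda>m. ln ((N b m * (a + b)\<^sup>2 - N (- b) m * (a - b)\<^sup>2) / (4 * a * b * N a m)))
     \<longlonglongrightarrow> ln ((exp (b * T) * (a + b)\<^sup>2 - exp (- b * T) * (a - b)\<^sup>2) / (4 * a * b * exp (a * T)))"
  proof -
    \<comment> \<open>The limit inside \<open>ln\<close> must be nonzero for \<open>ln\<close> to be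
      continuous there.\<close>
    have "exp (- b * T) * (a - b)\<^sup>2 < exp (b * T) * (a + b)\<^sup>2"
    proof (rule mult_strict_mono)
      show "(a - b)\<^sup>2 < (a + b)\<^sup>2"
        using assms by (simp add: power2_eq_square algebra_simps)
    qed (use assms in auto)
    then show ?thesis
      unfolding N_def using assms by (intro tendsto_intros tendsto_exp_odd) auto
  qed
  ultimately have "(\<Sum>j. B j) = ln ((exp (b * T) * (a + b)\<^sup>2 - exp (- b * T) * (a - b)\<^sup>2) / (4 * a * b * exp (a * T)))"
    using LIMSEQ_unique by simp
  then show ?thesis
    by (simp add: B_def x_def)
qed

section \<open>The Shannon integral in closed form\<close>

lemma integral_ln_rational:
  fixes a b :: real
  assumes "a > 0" "b > a"
  shows "(\<integral>w. ln (1 + (b\<^sup>2 - a\<^sup>2) / (a\<^sup>2 + w\<^sup>2)) \<partial>lborel) = 2 * pi * (b - a)"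
proof -
  define f where "f w = ln (1 + (b\<^sup>2 - a\<^sup>2) / (a\<^sup>2 + w\<^sup>2))" for w
  \<comment> \<open>The antiderivative comes from integration by parts: the arctangent terms are an
    antiderivative of \<open>- w * f' w\<close>.\<close>
  define F where "F w = w * f w + 2 * b * arctan (w / b) - 2 * a * arctan (w / a)" for w
  have ab: "b\<^sup>2 - a\<^sup>2 > 0" using assms by (simp add: power_strict_mono)
  have pos: "a\<^sup>2 + w\<^sup>2 > 0" "b\<^sup>2 + w\<^sup>2 > 0" for w
    using assms by (auto intro!: add_pos_nonneg)
  have f: "f w = ln (b\<^sup>2 + w\<^sup>2) - ln (a\<^sup>2 + w\<^sup>2)" for w
  proof -
    have "1 + (b\<^sup>2 - a\<^sup>2) / (a\<^sup>2 + w\<^sup>2) = (b\<^sup>2 + w\<^sup>2) / (a\<^sup>2 + w\<^sup>2)"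
      using assms by (intro one_plus_diff_divide) simp
    then show ?thesis using assms pos[of w] by (simp add: f_def ln_div)
  qed
  have F': "(F has_real_derivative f w) (at w)" for w
  proof -
    have "((\<lambda>w. ln (b\<^sup>2 + w\<^sup>2) - ln (a\<^sup>2 + w\<^sup>2)) has_real_derivative
        2 * w / (b\<^sup>2 + w\<^sup>2) - 2 * w / (a\<^sup>2 + w\<^sup>2)) (at w)"
      using pos[of w] by (auto intro!: derivative_eq_intros)
    then have "(f has_real_derivative 2 * w / (b\<^sup>2 + w\<^sup>2) - 2 * w / (a\<^sup>2 + w\<^sup>2)) (at w)"
      by (simp add: f[abs_def])
    moreover have "((\<lambda>w. 2 * c * arctan (w / c)) has_real_derivative 2 * c\<^sup>2 / (c\<^sup>2 + w\<^sup>2)) (at w)" if "c > 0" for c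
    proof -
      have "c\<^sup>2 + w\<^sup>2 > 0" using that by (auto intro!: add_pos_nonneg)
      then show ?thesis
        using that by (auto intro!: derivative_eq_intros simp: power_divide field_simps power2_eq_square)
    qed
    ultimately have "(F has_real_derivative (1 * f w + (2 * w / (b\<^sup>2 + w\<^sup>2) - 2 * w / (a\<^sup>2 + w\<^sup>2)) * w
        + 2 * b\<^sup>2 / (b\<^sup>2 + w\<^sup>2) - 2 * a\<^sup>2 / (a\<^sup>2 + w\<^sup>2))) (at w)"
      unfolding F_def using assms by (intro DERIV_diff DERIV_add DERIV_mult DERIV_ident) auto
    \<comment> \<open>The instances for \<open>b\<close> and \<open>a\<close> cancel in the
      derivative of \<open>F\<close>, leaving \<open>f w\<close>.\<close>
    moreover have "2 * w / (c\<^sup>2 + w\<^sup>2) * w + 2 * c\<^sup>2 / (c\<^sup>2 + w\<^sup>2) = 2" if "c > 0" for c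
    proof -
      have "2 * w / d * w + 2 * c\<^sup>2 / d = 2 * (c\<^sup>2 + w\<^sup>2) / d" for d
        by (simp add: add_divide_distrib power2_eq_square algebra_simps)
      moreover have "c\<^sup>2 + w\<^sup>2 \<noteq> 0"
        using that by (simp add: sum_power2_eq_zero_iff)
      ultimately show ?thesis
        by (metis nonzero_mult_div_cancel_right)
    qed
    from this[of b] this[of a] have "2 * w / (b\<^sup>2 + w\<^sup>2) * w + 2 * b\<^sup>2 / (b\<^sup>2 + w\<^sup>2) = 2"
        "2 * w / (a\<^sup>2 + w\<^sup>2) * w + 2 * a\<^sup>2 / (a\<^sup>2 + w\<^sup>2) = 2"
      using assms by simp_all
    ultimately show ?thesis
      by (elim DERIV_cong) (simp add: left_diff_distrib)
  qed
  \<comment> \<open>Here \<open>w * f w\<close> tends to 0, as \<open>f\<close> decays like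
    \<open>1 / w^2\<close>; the arctangents give \<open>pi * b - pi * a\<close>.\<close>
  have top: "(F \<longlongrightarrow> pi * (b - a)) at_top"
    unfolding F_def f_def using assms by (real_asymp, simp add: algebra_simps)
  have bot: "(F \<longlongrightarrow> - (pi * (b - a))) at_bot"
    unfolding F_def f_def using assms by (real_asymp, simp add: algebra_simps)
  have "(LBINT w=-\<infinity>..\<infinity>. f w) = pi * (b - a) - - (pi * (b - a))"
  \<comment> \<open>For nonnegative \<open>f\<close>, the limits of \<open>F\<close> at both ends
    yield the value of the integral without a separate integrability proof.\<close>
  proof (rule interval_integral_FTC_nonneg(2))
    show "isCont f w" for w
      unfolding f[abs_def] using pos by (auto intro!: continuous_intros simp: less_imp_neq[symmetric])
    have "f w \<ge> 0" for w
      unfolding f_def using ab pos[of w] by simp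
    then show "AE x in lborel. -\<infinity> < ereal x \<longrightarrow> ereal x < \<infinity> \<longrightarrow> 0 \<le> f x"
      by simp
  qed (use F' top bot in \<open>auto simp: ereal_tendsto_simps\<close>)
  then show ?thesis
    by (simp add: f_def[abs_def] interval_lebesgue_integral_def set_lebesgue_integral_def algebra_simps)
qed

section \<open>Comparison of the finite-time rate with the Shannon capacity\<close>

theorem theorem2:
  fixes T n0 \<alpha> :: real
  assumes "T > 0" and "n0 > 0" and "\<alpha> > 0"
  shows "\<exists>\<delta>>0. \<forall>P. 0 < P \<and> P < \<delta> \<longrightarrow> C_T T n0 \<alpha> P > C_sh n0 \<alpha> P"
\<comment> \<open>The witness 1 is an arbitrary positive number.\<close>
proof (intro exI[of _ 1] conjI allI impI)
  fix P :: real assume P: "0 < P \<and> P < 1"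
  \<comment> \<open>With this \<open>b\<close>, both rates contain the logarithm of
    \<open>1 + (b^2 - \<alpha>^2) / (\<alpha>^2 + w^2)\<close>, at \<open>w = omega_k\<close> and
    under the integral.\<close>
  define b where "b = sqrt (\<alpha>\<^sup>2 + 4 * \<alpha> * P / n0)"
  have b2: "b\<^sup>2 - \<alpha>\<^sup>2 = 4 * \<alpha> * P / n0"
    using assms P by (simp add: b_def)
  have "b > \<alpha>"
    unfolding b_def using assms P by (intro real_less_rsqrt) auto
  have "C_sh n0 \<alpha> P = 1 / (4 * pi) * (2 * pi * (b - \<alpha>))"
    unfolding C_sh_def integral_ln_rational[OF assms(3) \<open>b > \<alpha>\<close>, symmetric] b2
    by (simp add: mult_ac)
  then have sh: "2 * T * C_sh n0 \<alpha> P = (b - \<alpha>) * T"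
    by simp
  have "C_T T n0 \<alpha> P = 1 / (2 * T) *
      ln ((exp (b * T) * (\<alpha> + b)\<^sup>2 - exp (- b * T) * (\<alpha> - b)\<^sup>2) / (4 * \<alpha> * b * exp (\<alpha> * T)))"
    unfolding C_T_def lambda_k_def suminf_ln_omega_k[OF assms(1,3) \<open>b > \<alpha>\<close>, symmetric] b2
    by (simp add: mult_ac)
  then have CT: "2 * T * C_T T n0 \<alpha> P =
      ln ((exp (b * T) * (\<alpha> + b)\<^sup>2 - exp (- b * T) * (\<alpha> - b)\<^sup>2) / (4 * \<alpha> * b * exp (\<alpha> * T)))"
    using assms by simp
  \<comment> \<open>This is the source of strictness; afterwards
    \<open>(\<alpha> + b)^2 - (\<alpha> - b)^2 = 4 * \<alpha> * b\<close> leaves exactly the Shannon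
    term.\<close>
  have "exp (- b * T) * (\<alpha> - b)\<^sup>2 < exp (b * T) * (\<alpha> - b)\<^sup>2"
    using assms \<open>b > \<alpha>\<close> by (intro mult_strict_right_mono) auto
  then have "exp (b * T) * (4 * \<alpha> * b) < exp (b * T) * (\<alpha> + b)\<^sup>2 - exp (- b * T) * (\<alpha> - b)\<^sup>2"
    by (simp add: power2_eq_square algebra_simps)
  moreover have "exp ((b - \<alpha>) * T) = exp (b * T) / exp (\<alpha> * T)"
    by (simp add: exp_diff left_diff_distrib)
  ultimately have "exp ((b - \<alpha>) * T) <
      (exp (b * T) * (\<alpha> + b)\<^sup>2 - exp (- b * T) * (\<alpha> - b)\<^sup>2) / (4 * \<alpha> * b * exp (\<alpha> * T))"
    using assms \<open>b > \<alpha>\<close> by (simp add: field_simps)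
  then have "ln (exp ((b - \<alpha>) * T)) < 2 * T * C_T T n0 \<alpha> P"
    unfolding CT by (subst ln_less_cancel_iff) (auto intro: less_trans[OF exp_gt_zero])
  then have "2 * T * C_sh n0 \<alpha> P < 2 * T * C_T T n0 \<alpha> P"
    unfolding sh by simp
  then show "C_sh n0 \<alpha> P < C_T T n0 \<alpha> P"
    using assms by simp
qed simp

end
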